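(* Let $\xi(n,t)=(\xi_1(n,t),\xi_2(n,t),\xi_3(n,t),\xi_4(n,t))$, for integers $n\ge 0$, be given by the closed formulas in the context, and let $\zeta$ be the birational map on $X_4$ defined in the context. Then: 1. $\xi(0,t)=(t+1,t+2,t+3,t+4)$. 2. $\xi(1,t)=(2t^3+12t^2+19t+6,\ 2t^3+14t^2+31t+23,\ 2t^3+16t^2+41t+32,\ 2t^3+18t^2+49t+39)$. 3. For all $n\ge 0$, $\xi(n+2,t)=f(t)\,\xi(n+1,t)-\xi(n,t)$, where $f(t)=2t^2+10t+10$. 4. For each $n\ge 0$, $\xi(n,t)$ is a $4$-tuple of polynomials of degree $2n+1$ in the variable $t$. 5. For all $n\ge 0$ and $t\in\mathbb{Z}$, the sequence $\xi(n,t)$ is a Büchi sequence. 6. For all $n\ge 0$, $\zeta^{(n)}(t+1,t+2,t+3,t+4)=\xi(n,t)$ (with $t$ a variable, i.e. as an equality of points of $X_4$ over $\mathbb{Q}(t)$).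
   Context: A sequence $(x_1,\dots,x_\ell)$ of elements of a commutative ring $A$ with unit is a Büchi sequence over $A$ if $x_i^2-2x_{i+1}^2+x_{i+2}^2=2$ for each $i\in\{1,\dots,\ell-2\}$; here $A=\mathbb{Z}$ and $\ell=4$. Closed formulas. Let $t$ be a variable, $\alpha=\sqrt{(t+1)(t+2)(t+3)(t+4)}$ (in a quadratic extension of $\mathbb{Q}(t)$), $\beta=t^2+5t+5+\alpha$ and $\bar\beta=t^2+5t+5-\alpha$. For $n\ge0$, $$\xi_1(n,t)=\frac{(t^3+6t^2+9t+1+\alpha(t+1))\beta^n-(t^3+6t^2+9t+1-\alpha(t+1))\bar\beta^n}{2\alpha},$$ $$\xi_2(n,t)=\frac{(t^3+7t^2+16t+13+\alpha(t+2))\beta^n-(t^3+7t^2+16t+13-\alpha(t+2))\bar\beta^n}{2\alpha},$$ $$\xi_3(n,t)=\frac{(t^3+8t^2+21t+17+\alpha(t+3))\beta^n-(t^3+8t^2+21t+17-\alpha(t+3))\bar\beta^n}{2\alpha},$$ $$\xi_4(n,t)=\frac{(t^3+9t^2+24t+19+\alpha(t+4))\beta^n-(t^3+9t^2+24t+19-\alpha(t+4))\bar\beta^n}{2\alpha}.$$ For $t\in\mathbb{Z}$, $\xi(n,t)$ means the value at $t$ of the corresponding polynomials. $X_4$ is the affine variety over $\mathbb{Q}$ in coordinates $(x_1,x_2,x_3,x_4)$ defined by $x_4^2-2x_3^2+x_2^2=2$ and $x_3^2-2x_2^2+x_1^2=2$. Products of maps denote composition, and $\zeta^{(n)}$ is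 the $n$-fold composition of $\zeta$ with itself ($\zeta^{(0)}$ is the identity). Let $\tau(a,b,c,d)=(d,c,b,a)$ and $\mu_{14}(a,b,c,d)=(-a,b,c,-d)$. Let $\varphi=\left(\frac{p_1}{q},\frac{p_2}{q},\frac{p_3}{q},\frac{p_4}{q}\right)$, where, in the variables $(a,b,c,d)$, $$q=(b-c)^2(a-2b+c),$$ $$p_1=-2ab^3+ab^2c+2ab^2d+4abc^2-5abcd+ab-2ac^3+2ac^2d+ac-ad+3b^4-2b^3c-3b^3d-6b^2c^2+8b^2cd+b^2+4bc^3-4bc^2d-5bc+bd+c^2+cd-2,$$ $$p_2=-2ab^2c+5abc^2-2abcd+2ab-2ac^3+ac^2d-ad+3b^3c-8b^2c^2+3b^2cd-2b^2+4bc^3-2bc^2d-bc+2bd-2,$$ $$p_3=-2ab^3+5ab^2c-2ab^2d-2abc^2+abcd+3ab-ac-ad+3b^4-8b^3c+3b^3d+4b^2c^2-2b^2cd-3b^2-bc+3bd+c^2-cd-2,$$ $$p_4=-3ab^3+8ab^2c-3ab^2d-4abc^2+2abcd+4ab-2ac-ad+4b^4-10b^3c+4b^3d+2b^2c^2-2b^2cd-4b^2+5bc^3-2bc^2d-bc+4bd-2c^4+c^3d+2c^2-2cd-2.$$ Then $\varphi$ is a birational map on $X_4$, and $\zeta=\varphi\tau\mu_{14}$, i.e. $\zeta(a,b,c,d)=\varphi(-d,c,b,-a)$. *)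

theory Defs
  imports
    "HOL-Computational_Algebra.Polynomial_Factorial"
    "HOL-Algebra.Algebraic_Closure_Type"
    "HOL-Library.Product_Plus"
begin

definition buchi_sequence :: "'a::comm_ring_1 list \<Rightarrow> bool" where
  "buchi_sequence x \<longleftrightarrow>
     (\<forall>i. i + 2 < length x \<longrightarrow> (x ! i)^2 - 2 * (x ! (i + 1))^2 + (x ! (i + 2))^2 = 2)"

type_synonym 'a quad = "'a \<times> 'a \<times> 'a \<times> 'a"

fun map_quad :: "('a \<Rightarrow> 'b) \<Rightarrow> 'a quad \<Rightarrow> 'b quad" where
  "map_quad g (a, b, c, d) = (g a, g b, g c, g d)"

fun list_of_quad :: "'a quad \<Rightarrow> 'a list" where
  "list_of_quad (a, b, c, d) = [a, b, c, d]"


text \<open>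
  The field \<open>\<rat>(t)\<close> is \<^typ>\<open>rat poly fract\<close>. The quadratic extension containing \<open>\<alpha>\<close> is taken inside
  a fixed algebraic closure of it; there \<open>\<alpha>\<close> is a parameter, standing for either of the two square
  roots of \<open>(t+1)(t+2)(t+3)(t+4)\<close>.
\<close>

type_synonym Qt = "rat poly fract"
type_synonym Qt_closure = "Qt alg_closure"

definition of_poly :: "rat poly \<Rightarrow> Qt_closure" where
  "of_poly p = to_ac (to_fract p)"

definition t_var :: Qt_closure where
  "t_var = of_poly [:0, 1:]"

definition is_alpha :: "Qt_closure \<Rightarrow> bool" where
  "is_alpha \<alpha> \<longleftrightarrow> \<alpha>^2 = (t_var + 1) * (t_var + 2) * (t_var + 3) * (t_var + 4)"

definition beta :: "Qt_closure \<Rightarrow> Qt_closure" where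
  "beta \<alpha> = t_var^2 + 5 * t_var + 5 + \<alpha>"

definition beta_bar :: "Qt_closure \<Rightarrow> Qt_closure" where
  "beta_bar \<alpha> = t_var^2 + 5 * t_var + 5 - \<alpha>"

definition xi1 :: "Qt_closure \<Rightarrow> nat \<Rightarrow> Qt_closure" where
  "xi1 \<alpha> n = (let t = t_var in
     ((t^3 + 6*t^2 + 9*t + 1 + \<alpha> * (t + 1)) * beta \<alpha> ^ n
      - (t^3 + 6*t^2 + 9*t + 1 - \<alpha> * (t + 1)) * beta_bar \<alpha> ^ n) / (2 * \<alpha>))"

definition xi2 :: "Qt_closure \<Rightarrow> nat \<Rightarrow> Qt_closure" where
  "xi2 \<alpha> n = (let t = t_var in
     ((t^3 + 7*t^2 + 16*t + 13 + \<alpha> * (t + 2)) * beta \<alpha> ^ n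
      - (t^3 + 7*t^2 + 16*t + 13 - \<alpha> * (t + 2)) * beta_bar \<alpha> ^ n) / (2 * \<alpha>))"

definition xi3 :: "Qt_closure \<Rightarrow> nat \<Rightarrow> Qt_closure" where
  "xi3 \<alpha> n = (let t = t_var in
     ((t^3 + 8*t^2 + 21*t + 17 + \<alpha> * (t + 3)) * beta \<alpha> ^ n
      - (t^3 + 8*t^2 + 21*t + 17 - \<alpha> * (t + 3)) * beta_bar \<alpha> ^ n) / (2 * \<alpha>))"

definition xi4 :: "Qt_closure \<Rightarrow> nat \<Rightarrow> Qt_closure" where
  "xi4 \<alpha> n = (let t = t_var in
     ((t^3 + 9*t^2 + 24*t + 19 + \<alpha> * (t + 4)) * beta \<alpha> ^ n
      - (t^3 + 9*t^2 + 24*t + 19 - \<alpha> * (t + 4)) * beta_bar \<alpha> ^ n) / (2 * \<alpha>))"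

definition xi :: "Qt_closure \<Rightarrow> nat \<Rightarrow> Qt_closure quad" where
  "xi \<alpha> n = (xi1 \<alpha> n, xi2 \<alpha> n, xi3 \<alpha> n, xi4 \<alpha> n)"

text \<open>
  The polynomials corresponding to \<^const>\<open>xi\<close>. As \<^const>\<open>of_poly\<close> is injective, there is at most one such
  tuple; that there is one at all is not built into the definition but has to be proved.
\<close>

definition xi_poly :: "Qt_closure \<Rightarrow> nat \<Rightarrow> rat poly quad" where
  "xi_poly \<alpha> n = (THE P. map_quad of_poly P = xi \<alpha> n)"

definition xi_at :: "Qt_closure \<Rightarrow> nat \<Rightarrow> rat \<Rightarrow> rat quad" where
  "xi_at \<alpha> n s = map_quad (\<lambda>p. poly p s) (xi_poly \<alpha> n)"


text \<open>The points of the variety \<open>X\<^sub>4\<close> with coordinates in a field.\<close>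

definition X4 :: "'a::field quad set" where
  "X4 = {(x1, x2, x3, x4). x4^2 - 2 * x3^2 + x2^2 = 2 \<and> x3^2 - 2 * x2^2 + x1^2 = 2}"

fun tau :: "'a quad \<Rightarrow> 'a quad" where
  "tau (a, b, c, d) = (d, c, b, a)"

fun mu14 :: "'a::field quad \<Rightarrow> 'a quad" where
  "mu14 (a, b, c, d) = (-a, b, c, -d)"

fun phi_q :: "'a::field quad \<Rightarrow> 'a" where
  "phi_q (a, b, c, d) = (b - c)^2*(a - 2*b + c)"

fun phi_p1 :: "'a::field quad \<Rightarrow> 'a" where
  "phi_p1 (a, b, c, d) =
     -2*a*b^3 + a*b^2*c + 2*a*b^2*d + 4*a*b*c^2 - 5*a*b*c*d + a*b - 2*a*c^3 + 2*a*c^2*d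
     + a*c - a*d + 3*b^4 - 2*b^3*c - 3*b^3*d - 6*b^2*c^2 + 8*b^2*c*d + b^2 + 4*b*c^3
     - 4*b*c^2*d - 5*b*c + b*d + c^2 + c*d - 2"

fun phi_p2 :: "'a::field quad \<Rightarrow> 'a" where
  "phi_p2 (a, b, c, d) =
     -2*a*b^2*c + 5*a*b*c^2 - 2*a*b*c*d + 2*a*b - 2*a*c^3 + a*c^2*d - a*d + 3*b^3*c
     - 8*b^2*c^2 + 3*b^2*c*d - 2*b^2 + 4*b*c^3 - 2*b*c^2*d - b*c + 2*b*d - 2"

fun phi_p3 :: "'a::field quad \<Rightarrow> 'a" where
  "phi_p3 (a, b, c, d) =
     -2*a*b^3 + 5*a*b^2*c - 2*a*b^2*d - 2*a*b*c^2 + a*b*c*d + 3*a*b - a*c - a*d + 3*b^4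
     - 8*b^3*c + 3*b^3*d + 4*b^2*c^2 - 2*b^2*c*d - 3*b^2 - b*c + 3*b*d + c^2 - c*d - 2"

fun phi_p4 :: "'a::field quad \<Rightarrow> 'a" where
  "phi_p4 (a, b, c, d) =
     -3*a*b^3 + 8*a*b^2*c - 3*a*b^2*d - 4*a*b*c^2 + 2*a*b*c*d + 4*a*b - 2*a*c - a*d
     + 4*b^4 - 10*b^3*c + 4*b^3*d + 2*b^2*c^2 - 2*b^2*c*d - 4*b^2 + 5*b*c^3 - 2*b*c^2*d
     - b*c + 4*b*d - 2*c^4 + c^3*d + 2*c^2 - 2*c*d - 2"

text \<open>
  A rational map on \<open>X\<^sub>4\<close> is rendered by the partial function on points that its defining fractions
  give. Its domain consists of the points of \<open>X\<^sub>4\<close> where the denominator \<open>q\<close> does not vanish; the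
  rational map may be regular at further points, so an equation \<open>phi P = Some Q\<close> is at least as strong
  as saying that the rational map is defined at \<open>P\<close> with value \<open>Q\<close>.
\<close>

definition phi :: "'a::field quad \<rightharpoonup> 'a quad" where
  "phi P = (if P \<in> X4 \<and> phi_q P \<noteq> 0
            then Some (phi_p1 P / phi_q P, phi_p2 P / phi_q P,
                       phi_p3 P / phi_q P, phi_p4 P / phi_q P)
            else None)"

definition zeta :: "'a::field quad \<rightharpoonup> 'a quad" where
  "zeta = phi \<circ> tau \<circ> mu14"

text \<open>The \<open>n\<close>-fold composition of partial maps; \<^term>\<open>Some\<close> is the identity.\<close>

definition zeta_iter :: "nat \<Rightarrow> 'a::field quad \<rightharpoonup> 'a quad" where
  "zeta_iter n = ((\<lambda>g. zeta \<circ>\<^sub>m g) ^^ n) Some"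

end

theory Submission
  imports Defs
begin

text \<open>
  Put \<open>U = t\<^sup>2 + 5t + 4\<close>, so that \<open>\<alpha>\<^sup>2 = U\<^sup>2 + 2U\<close> and \<open>\<beta> = U + 1 + \<alpha>\<close> is a unit of norm 1.
  Writing \<open>\<beta>\<^sup>n = v + (\<alpha> - U) y\<close> with \<open>v\<close>, \<open>y\<close> polynomials in \<open>t\<close>, the norm condition becomes
  \<open>v\<^sup>2 - 2U (v y + y\<^sup>2) = 1\<close>, and the closed formulas become
  \<open>((t+1) v - 3y, (t+2) v + (2t+5) y, (t+3) v + (2t+5) y, (t+4) v + 3y)\<close>. Both the membership in
  \<open>X\<^sub>4\<close> and the equation \<open>\<zeta>(\<xi>(n)) = \<xi>(n+1)\<close> are polynomial identities in \<open>t\<close>, \<open>v\<close>, \<open>y\<close> modulo the norm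
  condition. The denominator of \<open>\<zeta>\<close> at \<open>\<xi>(n)\<close> is \<open>-2 (t+4) v\<^sup>2 (v + y)\<close>; it is a nonzero polynomial
  because its value at \<open>t = 0\<close> is negative.
\<close>

section \<open>Powers of the unit \<beta> and a Pell-type equation\<close>

fun pell_v pell_y :: "'a::comm_ring_1 \<Rightarrow> nat \<Rightarrow> 'a" where
  "pell_v t 0 = 1"
| "pell_y t 0 = 0"
| "pell_v t (Suc n) = (2*(t^2 + 5*t + 4) + 1) * pell_v t n + 2*(t^2 + 5*t + 4) * pell_y t n"
| "pell_y t (Suc n) = pell_v t n + pell_y t n"

text \<open>The left side is the norm of \<open>v + (\<alpha> - U) y\<close>, which multiplication
  by \<beta>, of norm \<open>(U + 1)^2 - (U^2 + 2*U) = 1\<close>, preserves.\<close>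

lemma pell_equation:
  "pell_v t n ^ 2 - 2*(t^2 + 5*t + 4) * (pell_v t n * pell_y t n + pell_y t n ^ 2) = 1"
proof (induction n)
  case (Suc n)
  have "((2*U + 1)*v + 2*U*y)^2 - 2*U * (((2*U + 1)*v + 2*U*y) * (v + y) + (v + y)^2)
      = v^2 - 2*U * (v * y + y^2)" for U v y :: 'a
    by (simp add: power2_eq_square algebra_simps)
  with Suc show ?case
    by (simp only: pell_v.simps pell_y.simps)
qed simp

text \<open>Since \<open>A\<close> and \<open>B\<close> do not depend on \<open>n\<close>,
  recurrence and degree can be treated once for all four coordinates.\<close>

definition pell_comb :: "'a::comm_ring_1 \<Rightarrow> 'a \<Rightarrow> 'a \<Rightarrow> nat \<Rightarrow> 'a" where
  "pell_comb t A B n = A * pell_v t n + B * pell_y t n"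

lemma pell_comb_0 [simp]: "pell_comb t A B 0 = A"
  by (simp add: pell_comb_def)

lemma pell_comb_1: "pell_comb t A B (Suc 0) = A * (2*(t^2 + 5*t + 4) + 1) + B"
  by (simp add: pell_comb_def)

text \<open>Cayley-Hamilton: the matrix sending \<open>(v, y)\<close> to its successor has trace
  \<open>2*U + 2\<close> and determinant 1.\<close>

lemma pell_comb_rec:
  "pell_comb t A B (n + 2) = (2*t^2 + 10*t + 10) * pell_comb t A B (n + 1) - pell_comb t A B n"
  by (simp add: pell_comb_def algebra_simps power2_eq_square)

section \<open>The tuple over an arbitrary commutative ring\<close>

definition xi_quad :: "'a::comm_ring_1 \<Rightarrow> nat \<Rightarrow> 'a quad" where
  "xi_quad t n =
     (pell_comb t (t + 1) (- 3) n,
      pell_comb t (t + 2) (2*t + 5) n,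
      pell_comb t (t + 3) (2*t + 5) n,
      pell_comb t (t + 4) 3 n)"

lemma xi_quad_rec:
  "xi_quad t (n + 2) = map_quad ((*) (2*t^2 + 10*t + 10)) (xi_quad t (n + 1)) - xi_quad t n"
  unfolding xi_quad_def pell_comb_rec by simp

text \<open>The tuple is built from \<open>t\<close> by ring operations alone. This transfers it
  between integers, rationals, polynomials, \<open>\<rat>(t)\<close> and its closure.\<close>

lemma map_quad_xi_quad:
  fixes h :: "'a::comm_ring_1 \<Rightarrow> 'b::comm_ring_1"
  assumes add: "\<And>x y. h (x + y) = h x + h y"
    and mult: "\<And>x y. h (x * y) = h x * h y"
    and one: "h 1 = 1"
  shows "map_quad h (xi_quad t n) = xi_quad (h t) n"
proof -
  have zero: "h 0 = 0"
    using add[of 0 0] by simp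
  have diff: "h (x - y) = h x - h y" for x y
    using add[of "x - y" y] by (simp add: algebra_simps)
  have power: "h (x ^ k) = h x ^ k" for x k
    by (induction k) (simp_all add: one mult)
  have "h (of_nat k) = of_nat k" for k
    by (induction k) (simp_all add: zero one add)
  from this[of "numeral k" for k] have numeral: "h (numeral k) = numeral k" for k
    by simp
  note hom = zero one add diff mult power numeral
  have "h (pell_v t n) = pell_v (h t) n \<and> h (pell_y t n) = pell_y (h t) n"
    by (induction n) (simp_all add: hom)
  then show ?thesis
    by (simp add: xi_quad_def pell_comb_def hom)
qed

lemma xi_quad_second_differences:
  assumes "xi_quad t n = (a, b, c, d)"
  shows "a^2 - 2*b^2 + c^2 = 2" "b^2 - 2*c^2 + d^2 = 2"
proof -
  define v y where "v = pell_v t n" and "y = pell_y t n"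
  have eqs: "a = (t + 1)*v - 3*y" "b = (t + 2)*v + (2*t + 5)*y"
    "c = (t + 3)*v + (2*t + 5)*y" "d = (t + 4)*v + 3*y"
    using assms by (simp_all add: xi_quad_def pell_comb_def v_def y_def)
  \<comment> \<open>Both second differences are twice the norm of
    \<open>v + (\<alpha> - U) y\<close>.\<close>
  have "a^2 - 2*b^2 + c^2 = 2 * (v^2 - 2*(t^2 + 5*t + 4) * (v * y + y^2))"
    "b^2 - 2*c^2 + d^2 = 2 * (v^2 - 2*(t^2 + 5*t + 4) * (v * y + y^2))"
    unfolding eqs by (simp_all add: power2_eq_square algebra_simps)
  then show "a^2 - 2*b^2 + c^2 = 2" "b^2 - 2*c^2 + d^2 = 2"
    using pell_equation[of t n] by (simp_all only: v_def y_def mult_1_right)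
qed

lemma buchi_sequence_xi_quad: "buchi_sequence (list_of_quad (xi_quad t n))"
proof (cases "xi_quad t n")
  case (fields a b c d)
  have "i = 0 \<or> i = 1" if "i + 2 < length [a, b, c, d]" for i
    using that by auto
  then show ?thesis
    using xi_quad_second_differences[OF fields]
    unfolding buchi_sequence_def fields list_of_quad.simps by fastforce
qed

lemma xi_quad_in_X4: "xi_quad t n \<in> X4"
proof (cases "xi_quad t n")
  case (fields a b c d)
  show ?thesis
    using xi_quad_second_differences[OF fields] by (simp add: fields X4_def algebra_simps)
qed

section \<open>Iterating \<open>zeta\<close> along the tuples\<close>

lemma zeta_xi_quad:
  fixes t :: "'a::field"
  assumes "phi_q (tau (mu14 (xi_quad t n))) \<noteq> 0"
  shows "zeta (xi_quad t n) = Some (xi_quad t (Suc n))"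
proof -
  obtain a b c d where abcd: "xi_quad t n = (a, b, c, d)"
    by (cases "xi_quad t n")
  obtain a' b' c' d' where abcd': "xi_quad t (Suc n) = (a', b', c', d')"
    by (cases "xi_quad t (Suc n)")
  define R where "R = (-d, c, b, -a)"
  have R: "tau (mu14 (xi_quad t n)) = R"
    by (simp add: abcd R_def)
  have "R \<in> X4"
    using xi_quad_second_differences[OF abcd] by (simp add: X4_def R_def algebra_simps)
  define v y where "v = pell_v t n" and "y = pell_y t n"
  define v' y' where "v' = pell_v t (Suc n)" and "y' = pell_y t (Suc n)"
  have v': "v' = (2*(t^2 + 5*t + 4) + 1)*v + 2*(t^2 + 5*t + 4)*y" and y': "y' = v + y"
    by (simp_all add: v_def y_def v'_def y'_def)
  define E where "E = v^2 - 2*(t^2 + 5*t + 4) * (v * y + y^2) - 1"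
  have "E = 0"
    using pell_equation[of t n] by (simp add: E_def v_def y_def)
  have eqs: "a = (t + 1)*v - 3*y" "b = (t + 2)*v + (2*t + 5)*y"
    "c = (t + 3)*v + (2*t + 5)*y" "d = (t + 4)*v + 3*y"
    using abcd by (simp_all add: xi_quad_def pell_comb_def v_def y_def)
  have eqs': "a' = (t + 1)*v' - 3*y'" "b' = (t + 2)*v' + (2*t + 5)*y'"
    "c' = (t + 3)*v' + (2*t + 5)*y'" "d' = (t + 4)*v' + 3*y'"
    using abcd' by (simp_all add: xi_quad_def pell_comb_def v'_def y'_def del: pell_v.simps pell_y.simps)
  \<comment> \<open>Here \<open>c - b = v\<close> and
    \<open>- d - 2*c + b = - 2*(t + 4)*(v + y)\<close>; the norm condition is not involved.\<close>
  have q: "phi_q R = - 2 * (t + 4) * v^2 * (v + y)"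
    unfolding R_def phi_q.simps eqs by (simp add: algebra_simps power2_eq_square)
  \<comment> \<open>The cofactors of \<open>E\<close> are the quotients of \<open>phi_p\<^sub>i R - phi_q R * x\<^sub>i'\<close> on division by \<open>E\<close> as polynomials in \<open>v\<close>.\<close>
  have "phi_p1 R = phi_q R * a'
    + E * (8*(t + 2)*(t + 3)*v^2 + 4*(2*t + 5)^2*v*y + 2*(2*t + 5)^2*y^2 + 2)"
    unfolding q unfolding R_def phi_p1.simps eqs eqs' E_def v' y'
    by Groebner_Basis.algebra
  moreover have "phi_p2 R = phi_q R * b'
    + E * (4*(2*t + 5)*(t + 3)*v^2 + 2*(2*t + 5)*(4*t + 11)*v*y + 2*(2*t + 5)^2*y^2 + 2)"
    unfolding q unfolding R_def phi_p2.simps eqs eqs' E_def v' y'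
    by Groebner_Basis.algebra
  moreover have "phi_p3 R = phi_q R * c'
    + E * (2*(2*t + 5)*(2*t + 7)*v^2 + 8*(2*t + 5)*(t + 3)*v*y + 2*(2*t + 5)^2*y^2 + 2)"
    unfolding q unfolding R_def phi_p3.simps eqs eqs' E_def v' y'
    by Groebner_Basis.algebra
  moreover have "phi_p4 R = phi_q R * d'
    + E * (4*(2*t + 5)*(t + 4)*v^2 + 2*(2*t + 5)*(4*t + 13)*v*y + 2*(2*t + 5)^2*y^2 + 2)"
    unfolding q unfolding R_def phi_p4.simps eqs eqs' E_def v' y'
    by Groebner_Basis.algebra
  ultimately show ?thesis
    using assms \<open>R \<in> X4\<close> \<open>E = 0\<close> by (simp add: zeta_def phi_def R abcd')
qed

lemma phi_q_xi_quad_at_0: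
  fixes n :: nat
  shows "phi_q (tau (mu14 (xi_quad (0::rat) n))) < 0"
proof -
  \<comment> \<open>At \<open>t = 0\<close> the recurrence has the positive coefficients 9, 8, 1, 1,
    so signs propagate.\<close>
  have pos: "pell_v (0::rat) n > 0 \<and> pell_y (0::rat) n \<ge> 0"
    by (induction n) (auto intro!: add_pos_nonneg)
  have "phi_q (tau (mu14 (xi_quad (0::rat) n)))
    = - (8 * pell_v 0 n ^ 2 * (pell_v 0 n + pell_y 0 n))"
    by (simp add: xi_quad_def pell_comb_def power2_eq_square algebra_simps)
  also have "\<dots> < 0"
    using pos by (simp add: add_pos_nonneg)
  finally show ?thesis .
qed

lemma phi_q_xi_quad_fract:
  "phi_q (tau (mu14 (xi_quad (to_fract [:0, 1:] :: Qt) n))) \<noteq> 0"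
proof -
  obtain a b c d where abcd: "xi_quad ([:0, 1:] :: rat poly) n = (a, b, c, d)"
    by (cases "xi_quad ([:0, 1:] :: rat poly) n")
  have fract: "xi_quad (to_fract [:0, 1:] :: Qt) n = map_quad to_fract (a, b, c, d)"
    unfolding abcd[symmetric] by (rule map_quad_xi_quad[symmetric]) simp_all
  have at_0: "xi_quad (0::rat) n = map_quad (\<lambda>p. poly p 0) (a, b, c, d)"
    unfolding abcd[symmetric] by (subst map_quad_xi_quad) simp_all
  have two: "to_fract (2 :: rat poly) = 2"
    using to_fract_add[of "1 :: rat poly" 1] by simp
  \<comment> \<open>This is the denominator written out over \<open>rat poly\<close>, where
    \<open>phi_q\<close>, restricted to fields, cannot be applied.\<close>
  define q where "q = (c - b)^2 * (- d - 2 * c + b)"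
  have "poly q 0 = phi_q (tau (mu14 (xi_quad (0::rat) n)))"
    by (simp add: at_0 q_def)
  then have "q \<noteq> 0"
    using phi_q_xi_quad_at_0[of n] by auto
  moreover have "to_fract q = phi_q (tau (mu14 (xi_quad (to_fract [:0, 1:] :: Qt) n)))"
    by (simp add: fract q_def two power2_eq_square)
  ultimately show ?thesis
    by (metis to_fract_eq_0_iff)
qed

lemma zeta_iter_xi_quad:
  "zeta_iter n (xi_quad (to_fract [:0, 1:] :: Qt) 0) = Some (xi_quad (to_fract [:0, 1:]) n)"
proof (induction n)
  case 0
  show ?case by (simp add: zeta_iter_def)
next
  case (Suc n)
  then show ?case
    using zeta_xi_quad[OF phi_q_xi_quad_fract[of n]] by (simp add: zeta_iter_def map_comp_def)
qed

section \<open>Degrees\<close>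

lemma degree_second_order_rec:
  fixes p :: "nat \<Rightarrow> 'a::idom poly"
  assumes "\<And>n. p (n + 2) = f * p (n + 1) - p n"
    and "degree f = 2" "degree (p 0) = 1" "degree (p 1) = 3"
  shows "degree (p n) = 2 * n + 1"
proof -
  \<comment> \<open>The recurrence has order two, so the induction carries two consecutive degrees;
    \<open>f * p (n + 1)\<close> has larger degree than \<open>p n\<close>, so its leading term
    survives.\<close>
  have "degree (p n) = 2 * n + 1 \<and> degree (p (n + 1)) = 2 * n + 3"
  proof (induction n)
    case (Suc n)
    have "f \<noteq> 0" "p (n + 1) \<noteq> 0"
      using assms Suc by auto
    then have "degree (f * p (n + 1)) = 2 * n + 5"
      using assms Suc by (simp add: degree_mult_eq)
    then have "degree (f * p (n + 1) - p n) = 2 * n + 5"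
      using Suc degree_add_eq_left[of "- p n" "f * p (n + 1)"] by simp
    then show ?case
      using assms(1)[of n] Suc by simp
  qed (use assms in simp)
  then show ?thesis by simp
qed

text \<open>\<open>[:9, 10, 2:]\<close> is \<open>2*U + 1\<close>, so the second hypothesis concerns
  the value at \<open>n = 1\<close>.\<close>

lemma degree_pell_comb:
  fixes A B :: "rat poly"
  assumes "degree A = 1" "degree (A * [:9, 10, 2:] + B) = 3"
  shows "degree (pell_comb [:0, 1:] A B n) = 2 * n + 1"
proof (rule degree_second_order_rec)
  show "pell_comb [:0, 1:] A B (n + 2)
    = [:10, 10, 2:] * pell_comb [:0, 1:] A B (n + 1) - pell_comb [:0, 1:] A B n" for n
    unfolding pell_comb_rec by (simp add: power2_eq_square numeral_poly)
  show "degree (pell_comb [:0, 1:] A B 1) = 3"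
    using assms(2) by (simp add: pell_comb_1 power2_eq_square numeral_poly one_pCons)
qed (use assms in simp_all)

lemma degree_xi_quad:
  assumes "xi_quad ([:0, 1:] :: rat poly) n = (p1, p2, p3, p4)"
  shows "degree p1 = 2*n + 1 \<and> degree p2 = 2*n + 1 \<and> degree p3 = 2*n + 1 \<and> degree p4 = 2*n + 1"
proof -
  have "[:0, 1:]^2 = [:0, 0, 1 :: rat:]" "[:0, 1:]^3 = [:0, 0, 0, 1 :: rat:]"
    by (simp_all add: power2_eq_square power3_eq_cube)
  then show ?thesis
    using assms unfolding xi_quad_def
    by (auto simp: numeral_poly one_pCons degree_pell_comb)
qed

section \<open>From the closed formulas to polynomials\<close>

lemma of_poly_add: "of_poly (p + q) = of_poly p + of_poly q"
  and of_poly_mult: "of_poly (p * q) = of_poly p * of_poly q"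
  and of_poly_1: "of_poly 1 = 1"
  and of_poly_eq_iff: "of_poly p = of_poly q \<longleftrightarrow> p = q"
  by (simp_all add: of_poly_def)

lemma map_quad_of_poly_xi_quad: "map_quad of_poly (xi_quad [:0, 1:] n) = xi_quad t_var n"
  unfolding t_var_def by (rule map_quad_xi_quad) (simp_all add: of_poly_add of_poly_mult of_poly_1)

text \<open>Justifies the division by \<open>2 * \<alpha>\<close>: \<open>\<alpha>^2\<close> is the
  image of a nonzero polynomial under an injective map.\<close>

lemma is_alpha_nonzero:
  assumes "is_alpha \<alpha>"
  shows "\<alpha> \<noteq> 0"
proof
  assume "\<alpha> = 0"
  have "of_poly (of_nat k) = of_nat k" for k
    by (induction k) (simp_all add: of_poly_add of_poly_1 of_poly_def[of 0])
  then have const: "of_poly [:of_nat k:] = of_nat k" for k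
    by (simp add: of_nat_poly)
  have "of_poly ([:1, 1:] * [:2, 1:] * [:3, 1:] * [:4, 1:]) \<noteq> of_poly 0"
    unfolding of_poly_eq_iff by simp
  moreover have "of_poly [:of_nat k, 1:] = t_var + of_nat k" for k
    using const[of k] of_poly_add[of "[:0, 1:]" "[:of_nat k:]"] by (simp add: t_var_def)
  from this[of 1] this[of 2] this[of 3] this[of 4]
  have "of_poly ([:1, 1:] * [:2, 1:] * [:3, 1:] * [:4, 1:]) = \<alpha>^2"
    using assms by (simp only: of_poly_mult is_alpha_def) simp
  ultimately show False
    using \<open>\<alpha> = 0\<close> by (simp add: of_poly_def)
qed

lemma xi_eq_xi_quad:
  assumes "is_alpha \<alpha>"
  shows "xi \<alpha> n = xi_quad t_var n"
proof -
  let ?v = "pell_v t_var n" and ?y = "pell_y t_var n" and ?U = "t_var^2 + 5*t_var + 4"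
  have sq: "\<alpha> * \<alpha> = ?U^2 + 2*?U"
    using assms by (simp add: is_alpha_def power2_eq_square algebra_simps)
  \<comment> \<open>Stated for any root \<open>x\<close>, to serve both \<open>x = \<alpha>\<close>
    for \<open>beta\<close> and \<open>x = - \<alpha>\<close> for \<open>beta_bar\<close>.\<close>
  have step: "(U + 1 + x) * (v + (x - U) * y)
      = (2*U + 1)*v + 2*U*y + (x - U) * (v + y)"
    if "x * x = U^2 + 2*U" for U v y x :: Qt_closure
  proof -
    have "(U + 1 + x) * (v + (x - U) * y)
        = (2*U + 1)*v + 2*U*y + (x - U) * (v + y) + (x * x - (U^2 + 2*U)) * y"
      by (simp add: algebra_simps power2_eq_square)
    with that show ?thesis by simp
  qed
  have "beta \<alpha> = ?U + 1 + \<alpha>" "beta_bar \<alpha> = ?U + 1 + (- \<alpha>)"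
    by (simp_all add: beta_def beta_bar_def)
  then have pow: "beta \<alpha> ^ n = ?v + (\<alpha> - ?U) * ?y \<and> beta_bar \<alpha> ^ n = ?v + (- \<alpha> - ?U) * ?y"
  proof (induction n)
    case (Suc n)
    then show ?case
      using sq by (simp only: power_Suc step minus_mult_minus pell_v.simps pell_y.simps)
  qed simp
  \<comment> \<open>The quotient extracts the coefficient of \<alpha> in
    \<open>(C + \<alpha> * A) * (v + (\<alpha> - U) * y)\<close>, namely
    \<open>A * v + (C - A * U) * y\<close>.\<close>
  have comb: "((C + \<alpha> * A) * beta \<alpha> ^ n - (C - \<alpha> * A) * beta_bar \<alpha> ^ n) / (2 * \<alpha>)
    = pell_comb t_var A B n" if "C = B + A * ?U" for A B C
  proof -
    have "(C + \<alpha> * A) * beta \<alpha> ^ n - (C - \<alpha> * A) * beta_bar \<alpha> ^ n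
      = 2 * \<alpha> * pell_comb t_var A B n"
      unfolding that pow[THEN conjunct1] pow[THEN conjunct2] pell_comb_def
      by (simp add: algebra_simps)
    then show ?thesis
      using is_alpha_nonzero[OF assms] by simp
  qed
  show ?thesis
    unfolding xi_def xi1_def xi2_def xi3_def xi4_def xi_quad_def Let_def prod.inject
    by (intro conjI comb) (simp_all add: algebra_simps power2_eq_square power3_eq_cube)
qed

text \<open>Existence comes from the explicit tuple, uniqueness from injectivity of
  \<open>of_poly\<close>; the choice of root \<alpha> drops out.\<close>

lemma xi_poly_eq_xi_quad:
  assumes "is_alpha \<alpha>"
  shows "xi_poly \<alpha> n = xi_quad [:0, 1:] n"
  unfolding xi_poly_def xi_eq_xi_quad[OF assms] map_quad_of_poly_xi_quad[symmetric]
proof (rule the_equality)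
  show "P = xi_quad [:0, 1:] n" if "map_quad of_poly P = map_quad of_poly (xi_quad [:0, 1:] n)" for P
    using that by (cases P; cases "xi_quad ([:0, 1:] :: rat poly) n") (simp add: of_poly_eq_iff)
qed simp

lemma xi_at_eq_xi_quad:
  assumes "is_alpha \<alpha>"
  shows "xi_at \<alpha> n s = xi_quad s n"
  unfolding xi_at_def xi_poly_eq_xi_quad[OF assms] by (subst map_quad_xi_quad) simp_all

theorem theorem3p2:
  fixes \<alpha> :: Qt_closure
  assumes "is_alpha \<alpha>"
  shows
    "xi \<alpha> 0 = (t_var + 1, t_var + 2, t_var + 3, t_var + 4)
     \<and> xi \<alpha> 1 = (2*t_var^3 + 12*t_var^2 + 19*t_var + 6,
                  2*t_var^3 + 14*t_var^2 + 31*t_var + 23,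
                  2*t_var^3 + 16*t_var^2 + 41*t_var + 32,
                  2*t_var^3 + 18*t_var^2 + 49*t_var + 39)
     \<and> (\<forall>n. xi \<alpha> (n + 2) =
              map_quad (\<lambda>x. (2*t_var^2 + 10*t_var + 10) * x) (xi \<alpha> (n + 1)) - xi \<alpha> n)
     \<and> (\<forall>n. \<exists>p1 p2 p3 p4 :: rat poly.
              xi \<alpha> n = (of_poly p1, of_poly p2, of_poly p3, of_poly p4)
              \<and> degree p1 = 2*n + 1 \<and> degree p2 = 2*n + 1
              \<and> degree p3 = 2*n + 1 \<and> degree p4 = 2*n + 1)
     \<and> (\<forall>n. \<forall>s :: int. \<exists>x :: int quad.
              xi_at \<alpha> n (of_int s) = map_quad of_int x \<and> buchi_sequence (list_of_quad x))
     \<and> (\<forall>n. let t = to_fract [:0, 1:] :: Qt; P = map_quad to_fract (xi_poly \<alpha> n) in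
              P \<in> X4 \<and> zeta_iter n (t + 1, t + 2, t + 3, t + 4) = Some P)"
proof (intro conjI allI)
  note xi = xi_eq_xi_quad[OF assms]
  show "xi \<alpha> 0 = (t_var + 1, t_var + 2, t_var + 3, t_var + 4)"
    by (simp add: xi xi_quad_def)
  show "xi \<alpha> 1 = (2*t_var^3 + 12*t_var^2 + 19*t_var + 6,
                  2*t_var^3 + 14*t_var^2 + 31*t_var + 23,
                  2*t_var^3 + 16*t_var^2 + 41*t_var + 32,
                  2*t_var^3 + 18*t_var^2 + 49*t_var + 39)"
    by (simp add: xi xi_quad_def pell_comb_1 algebra_simps power2_eq_square power3_eq_cube)
  fix n
  show "xi \<alpha> (n + 2) =
          map_quad (\<lambda>x. (2*t_var^2 + 10*t_var + 10) * x) (xi \<alpha> (n + 1)) - xi \<alpha> n"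
    unfolding xi by (rule xi_quad_rec)
  obtain p1 p2 p3 p4 where p: "xi_quad ([:0, 1:] :: rat poly) n = (p1, p2, p3, p4)"
    by (cases "xi_quad ([:0, 1:] :: rat poly) n")
  show "\<exists>p1 p2 p3 p4 :: rat poly.
          xi \<alpha> n = (of_poly p1, of_poly p2, of_poly p3, of_poly p4)
          \<and> degree p1 = 2*n + 1 \<and> degree p2 = 2*n + 1
          \<and> degree p3 = 2*n + 1 \<and> degree p4 = 2*n + 1"
    using degree_xi_quad[OF p] map_quad_of_poly_xi_quad[of n] unfolding p xi
    by (metis map_quad.simps)
  show "\<exists>x :: int quad. xi_at \<alpha> n (of_int s) = map_quad of_int x \<and> buchi_sequence (list_of_quad x)"
    for s :: int
  proof (intro exI conjI)
    \<comment> \<open>The witness is the same tuple computed over the integers.\<close>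
    show "xi_at \<alpha> n (of_int s) = map_quad of_int (xi_quad s n)"
      unfolding xi_at_eq_xi_quad[OF assms] by (rule map_quad_xi_quad[symmetric]) simp_all
  qed (rule buchi_sequence_xi_quad)
  have "map_quad to_fract (xi_poly \<alpha> n) = xi_quad (to_fract [:0, 1:]) n"
    unfolding xi_poly_eq_xi_quad[OF assms] by (rule map_quad_xi_quad) simp_all
  moreover have "xi_quad (to_fract [:0, 1:] :: Qt) 0
    = (to_fract [:0, 1:] + 1, to_fract [:0, 1:] + 2, to_fract [:0, 1:] + 3, to_fract [:0, 1:] + 4)"
    by (simp add: xi_quad_def)
  ultimately show "let t = to_fract [:0, 1:] :: Qt; P = map_quad to_fract (xi_poly \<alpha> n) in
          P \<in> X4 \<and> zeta_iter n (t + 1, t + 2, t + 3, t + 4) = Some P"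
    using xi_quad_in_X4 zeta_iter_xi_quad by (metis (no_types, lifting))
qed

end
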